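(* Let $\mathcal{I},\mathcal{J}$ be admissible ideals on $\mathbf{N}$ and let $A=(a_{n,k})_{n,k\in\mathbf{N}}$ be an infinite real matrix. Consider the conditions: (T1) $\sup_n \sum_k |a_{n,k}| < \infty$; (T2) $\mathcal{J}\text{-}\lim_n \sum_k a_{n,k}=1$; (T3) $\mathcal{J}\text{-}\lim_n \sum_{k \in E} |a_{n,k}|=0$ for all $E \in \mathcal{I}$. If $A$ satisfies (T1), (T2) and (T3), then $A$ is $(\mathcal{I},\mathcal{J})$-regular. Conversely, if $A$ is $(\mathcal{I},\mathcal{J})$-regular, then it satisfies (T1) and (T2).
   Context: $\mathbf{N}$ is the set of positive integers. An ideal on $\mathbf{N}$ is a family of subsets of $\mathbf{N}$ closed under finite unions and under taking subsets; it is admissible if it contains every finite subset of $\mathbf{N}$ and is not equal to $\mathcal{P}(\mathbf{N})$. Let $\omega$ be the set of all real sequences indexed by $\mathbf{N}$. A sequence $x\in\omega$ is $\mathcal{I}$-convergent to $\eta\in\mathbf{R}$, written $\mathcal{I}\text{-}\lim x=\eta$ (or $\mathcal{I}\text{-}\lim_n x_n=\eta$), if $\{n\in\mathbf{N}: |x_n-\eta|>\varepsilon\}\in\mathcal{I}$ for all $\varepsilon>0$. $c(\mathcal{I})$ is the vector space of $\mathcal{I}$-convergent real sequences, and $\ell_\infty$ is the space of bounded real sequences. For an infinite real matrix $A=(a_{n,k})$ and $x\in\omega$, $Ax$ is the sequence $(\sum_k a_{n,k}x_k)_n$, which is well defined when all these series converge. For $X,Y\subseteq\omega$, $(X,Y)$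 denotes the set of infinite real matrices $A$ such that $Ax$ is well defined and belongs to $Y$ for all $x\in X$. A matrix $A$ is $(\mathcal{I},\mathcal{J})$-regular if $A\in(c(\mathcal{I})\cap\ell_\infty,\,c(\mathcal{J})\cap\ell_\infty)$ and $\mathcal{I}\text{-}\lim x=\mathcal{J}\text{-}\lim Ax$ for all $x\in c(\mathcal{I})\cap\ell_\infty$. *)

theory Defs
  imports "HOL-Analysis.Analysis"
begin

text \<open>
  The index set is the set of positive integers. Sequences and matrices are total functions
  on \<^typ>\<open>nat\<close> whose values at index \<open>0\<close> are never used by any definition below.
\<close>

abbreviation posnat :: "nat set" where
  "posnat \<equiv> {1..}"

definition ideal_on_posnat :: "nat set set \<Rightarrow> bool" where
  "ideal_on_posnat I \<longleftrightarrow>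
     I \<subseteq> Pow posnat \<and> {} \<in> I \<and>
     (\<forall>S\<in>I. \<forall>T\<in>I. S \<union> T \<in> I) \<and>
     (\<forall>S\<in>I. \<forall>T. T \<subseteq> S \<longrightarrow> T \<in> I)"

definition admissible_ideal :: "nat set set \<Rightarrow> bool" where
  "admissible_ideal I \<longleftrightarrow>
     ideal_on_posnat I \<and> (\<forall>S. S \<subseteq> posnat \<and> finite S \<longrightarrow> S \<in> I) \<and> I \<noteq> Pow posnat"

definition ideal_lim :: "nat set set \<Rightarrow> (nat \<Rightarrow> real) \<Rightarrow> real \<Rightarrow> bool" where
  "ideal_lim I x \<eta> \<longleftrightarrow> (\<forall>\<epsilon>>0. {n \<in> posnat. \<bar>x n - \<eta>\<bar> > \<epsilon>} \<in> I)"

definition ideal_conv_seqs :: "nat set set \<Rightarrow> (nat \<Rightarrow> real) set" where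
  "ideal_conv_seqs I = {x. \<exists>\<eta>. ideal_lim I x \<eta>}"

definition bounded_seqs :: "(nat \<Rightarrow> real) set" where
  "bounded_seqs = {x. bounded (x ` posnat)}"

text \<open>
  The series of \<open>A x\<close> are ordinary, possibly only conditionally convergent, series;
  the shift by \<^const>\<open>Suc\<close> makes the summation start at \<open>k = 1\<close>.
\<close>

definition mat_app :: "(nat \<Rightarrow> nat \<Rightarrow> real) \<Rightarrow> (nat \<Rightarrow> real) \<Rightarrow> nat \<Rightarrow> real" where
  "mat_app a x n = (\<Sum>k. a n (Suc k) * x (Suc k))"

definition mat_app_defined :: "(nat \<Rightarrow> nat \<Rightarrow> real) \<Rightarrow> (nat \<Rightarrow> real) \<Rightarrow> bool" where
  "mat_app_defined a x \<longleftrightarrow> (\<forall>n\<in>posnat. summable (\<lambda>k. a n (Suc k) * x (Suc k)))"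

definition mat_class ::
  "(nat \<Rightarrow> real) set \<Rightarrow> (nat \<Rightarrow> real) set \<Rightarrow> (nat \<Rightarrow> nat \<Rightarrow> real) set" where
  "mat_class X Y = {a. \<forall>x\<in>X. mat_app_defined a x \<and> mat_app a x \<in> Y}"

text \<open>
  Limits along an admissible ideal are unique, so the implication between limit statements
  below expresses equality of the two limits.
\<close>

definition ideal_regular ::
  "nat set set \<Rightarrow> nat set set \<Rightarrow> (nat \<Rightarrow> nat \<Rightarrow> real) \<Rightarrow> bool" where
  "ideal_regular I J a \<longleftrightarrow>
     a \<in> mat_class (ideal_conv_seqs I \<inter> bounded_seqs) (ideal_conv_seqs J \<inter> bounded_seqs) \<and>
     (\<forall>x \<in> ideal_conv_seqs I \<inter> bounded_seqs.
        \<forall>\<eta>. ideal_lim I x \<eta> \<longrightarrow> ideal_lim J (mat_app a x) \<eta>)"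

text \<open>The row sums are taken in \<^typ>\<open>ennreal\<close>, so that a divergent one is infinite.\<close>

definition cond_T1 :: "(nat \<Rightarrow> nat \<Rightarrow> real) \<Rightarrow> bool" where
  "cond_T1 a \<longleftrightarrow> (SUP n\<in>posnat. \<Sum>k. ennreal \<bar>a n (Suc k)\<bar>) < \<infinity>"

definition cond_T2 :: "nat set set \<Rightarrow> (nat \<Rightarrow> nat \<Rightarrow> real) \<Rightarrow> bool" where
  "cond_T2 J a \<longleftrightarrow>
     (\<forall>n\<in>posnat. summable (\<lambda>k. a n (Suc k))) \<and> ideal_lim J (\<lambda>n. \<Sum>k. a n (Suc k)) 1"

text \<open>
  The real-valued \<^const>\<open>infsum\<close> of a divergent series is \<open>0\<close>;
  summability is therefore required explicitly. It follows from \<^const>\<open>cond_T1\<close>.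
\<close>

definition cond_T3 :: "nat set set \<Rightarrow> nat set set \<Rightarrow> (nat \<Rightarrow> nat \<Rightarrow> real) \<Rightarrow> bool" where
  "cond_T3 I J a \<longleftrightarrow>
     (\<forall>E\<in>I. (\<forall>n\<in>posnat. (\<lambda>k. \<bar>a n k\<bar>) summable_on E) \<and>
            ideal_lim J (\<lambda>n. \<Sum>\<^sub>\<infinity>k\<in>E. \<bar>a n k\<bar>) 0)"

end

theory Submission
  imports Defs
begin

text \<open>
  Sufficiency: with \<open>E\<close> the set of indices where \<open>x\<close> is more than \<open>\<epsilon>\<close> away from \<open>\<eta>\<close>, the sum
  \<open>\<Sum>k. a n k * (x k - \<eta>)\<close> is at most a constant times the mass of row \<open>n\<close> on \<open>E\<close>, which is
  small along \<open>J\<close> by (T3), plus \<open>\<epsilon>\<close> times the uniform bound of (T1).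

  Necessity: (T2) is regularity at the constant sequence \<open>1\<close>. For (T1), null sequences are bounded
  and \<open>I\<close>-convergent, so the principle of uniform boundedness on \<open>c\<^sub>0\<close> applies twice: to the
  partial sums of one row, which gives absolute summability of the row, and then to all the rows.
  The principle itself is proved by a gliding hump.
\<close>

section \<open>Uniform boundedness on null sequences\<close>

text \<open>If the row masses were unbounded, one could pick rows \<open>i j\<close> and consecutive
  blocks from \<open>N j\<close> to \<open>N (Suc j)\<close> such that row \<open>i j\<close>
  carries almost all its mass on block \<open>j\<close>. A single null sequence following the signs
  of row \<open>i j\<close> on block \<open>j\<close> then has sums that grow with
  \<open>j\<close>.\<close>

lemma uniform_boundedness_null_sequences:
  fixes b :: "'i \<Rightarrow> nat \<Rightarrow> real"
  assumes sm: "\<And>i. i \<in> S \<Longrightarrow> summable (\<lambda>k. \<bar>b i k\<bar>)"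
    and pt: "\<And>x. x \<longlonglongrightarrow> 0 \<Longrightarrow> \<exists>B. \<forall>i\<in>S. \<bar>\<Sum>k. b i k * x k\<bar> \<le> B"
  shows "\<exists>C. \<forall>i\<in>S. (\<Sum>k. \<bar>b i k\<bar>) \<le> C"
proof (rule ccontr)
  assume "\<not> ?thesis"
  then have unb: "\<exists>i\<in>S. (\<Sum>k. \<bar>b i k\<bar>) > C" for C
    by (metis not_le)
  \<comment> \<open>Testing \<open>pt\<close> on the unit sequence at \<open>k\<close> bounds column
    \<open>k\<close> uniformly in \<open>i\<close>. Hence \<open>D m\<close> will bound the mass of
    every row before \<open>m\<close>, and it is known before the next row is chosen.\<close>
  have "\<exists>B. \<forall>i\<in>S. \<bar>b i k\<bar> \<le> B" for k
  proof -
    have "(\<lambda>m. if m = k then 1 else 0 :: real) \<longlonglongrightarrow> 0"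
      by (rule tendsto_eventually) (use eventually_gt_at_top[of k] in eventually_elim, auto)
    moreover have "(\<Sum>m. b i m * (if m = k then 1 else 0)) = b i k" for i
      by (subst suminf_finite[of "{k}"]) auto
    ultimately show ?thesis using pt by fastforce
  qed
  then obtain C where C: "\<And>k i. i \<in> S \<Longrightarrow> \<bar>b i k\<bar> \<le> C k"
    by metis
  define D where "D m = (\<Sum>k<m. C k)" for m
  \<comment> \<open>Removing a head of mass at most \<open>D m\<close> and a tail of mass at most 1
    leaves at least \<open>real (Suc j) * (D m + 1 + real j)\<close> on the block. After damping by
    \<open>Suc j\<close> this still outweighs head and tail by \<open>j\<close>.\<close>
  define P where "P j m m' i \<longleftrightarrow> m < m' \<and> i \<in> S \<and>
      (\<Sum>k. \<bar>b i k\<bar>) > D m + 1 + real (Suc j) * (D m + 1 + real j) \<and>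
      (\<Sum>k. \<bar>b i (k + m')\<bar>) \<le> 1" for j m m' i
  \<comment> \<open>Given \<open>m\<close>, the row is chosen first, and only then a cutoff
    \<open>m'\<close> beyond which that summable row has mass at most 1. The invariant on
    \<open>N\<close> itself is trivial.\<close>
  have "\<exists>N. \<forall>j. True \<and> (\<exists>i. P j (N j) (N (Suc j)) i)"
  proof (rule dependent_nat_choice)
    fix m j :: nat
    obtain i where i: "i \<in> S"
      "(\<Sum>k. \<bar>b i k\<bar>) > D m + 1 + real (Suc j) * (D m + 1 + real j)"
      using unb by blast
    have "(\<lambda>m'. \<Sum>k. \<bar>b i (k + m')\<bar>) \<longlonglongrightarrow> 0"
      using suminf_exist_split2[OF sm[OF i(1)]] by simp
    then have "eventually (\<lambda>m'. (\<Sum>k. \<bar>b i (k + m')\<bar>) < 1) sequentially"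
      by (rule order_tendstoD) simp
    with eventually_gt_at_top[of m] have "eventually (\<lambda>m'. P j m m' i) sequentially"
      by eventually_elim (use i in \<open>auto simp: P_def\<close>)
    then show "\<exists>m'. True \<and> (\<exists>i. P j m m' i)"
      by (auto simp: eventually_sequentially)
  qed auto
  then obtain N i where "\<And>j. P j (N j) (N (Suc j)) (i j)"
    by metis
  then have N: "N j < N (Suc j)" and iS: "i j \<in> S"
    and big: "(\<Sum>k. \<bar>b (i j) k\<bar>) > D (N j) + 1 + real (Suc j) * (D (N j) + 1 + real j)"
    and tail: "(\<Sum>k. \<bar>b (i j) (k + N (Suc j))\<bar>) \<le> 1" for j
    unfolding P_def by blast+
  have mono: "strict_mono N"
    using N by (simp add: strict_mono_Suc_iff)
  \<comment> \<open>\<open>J k\<close> is the number of the block containing \<open>k\<close>;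
    indices below \<open>N 0\<close> are assigned to block 0.\<close>
  define J where "J k = (LEAST j. k < N (Suc j))" for k
  have J_eq: "J k = j" if "N j \<le> k" "k < N (Suc j)" for j k
    unfolding J_def
  proof (rule Least_equality)
    fix y assume "k < N (Suc y)"
    with that(1) have "N j < N (Suc y)" by simp
    with mono show "j \<le> y" by (simp add: strict_mono_less)
  qed fact
  have J_ge: "j \<le> J k" if "N j \<le> k" for j k
  proof -
    \<comment> \<open>Strict monotonicity forces \<open>Suc k \<le> N (Suc k)\<close>, so the
      minimum defining \<open>J k\<close> exists.\<close>
    have "k < N (Suc k)"
      using strict_mono_imp_increasing[OF mono, of "Suc k"] by simp
    then have "k < N (Suc (J k))"
      unfolding J_def by (rule LeastI)
    with that have "N j < N (Suc (J k))" by simp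
    with mono show ?thesis by (simp add: strict_mono_less)
  qed
  \<comment> \<open>The sign turns the entries of row \<open>i j\<close> on block \<open>j\<close>
    into absolute values; the divisor makes \<open>x\<close> null.\<close>
  define x where "x k = sgn (b (i (J k)) k) / real (Suc (J k))" for k
  have x_le: "\<bar>x k\<bar> \<le> 1 / real (Suc (J k))" for k
    by (simp add: x_def sgn_if)
  have x_le_1: "\<bar>x k\<bar> \<le> 1" for k
    by (rule order_trans[OF x_le]) simp
  have "x \<longlonglongrightarrow> 0"
  proof (rule LIMSEQ_I)
    fix e :: real assume "e > 0"
    then obtain j where j: "1 / real (Suc j) < e"
      using nat_approx_posE by blast
    have "\<bar>x k\<bar> < e" if "k \<ge> N j" for k
    proof -
      have "1 / real (Suc (J k)) \<le> 1 / real (Suc j)"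
        using J_ge[OF that] by (intro divide_left_mono) auto
      with x_le[of k] j show ?thesis by linarith
    qed
    then show "\<exists>no. \<forall>n\<ge>no. norm (x n - 0) < e" by auto
  qed
  then obtain B where B: "\<And>i. i \<in> S \<Longrightarrow> \<bar>\<Sum>k. b i k * x k\<bar> \<le> B"
    using pt by blast
  have "real j \<le> B" for j
  proof -
    let ?b = "b (i j)" and ?m = "N j" and ?m' = "N (Suc j)"
    have sa: "summable (\<lambda>k. \<bar>?b k\<bar>)" using sm iS by blast
    have le: "\<bar>?b k * x k\<bar> \<le> \<bar>?b k\<bar>" for k
      using mult_left_mono[OF x_le_1[of k], of "\<bar>?b k\<bar>"] by (simp add: abs_mult)
    have sabs: "summable (\<lambda>k. \<bar>?b k * x k\<bar>)"
      by (rule summable_comparison_test'[OF sa]) (use le in auto)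
    then have sx: "summable (\<lambda>k. ?b k * x k)" by (rule summable_rabs_cancel)
    have set: "{..<?m'} = {..<?m} \<union> {?m..<?m'}" using N[of j] by auto
    have split: "sum f {..<?m'} = sum f {..<?m} + sum f {?m..<?m'}" for f :: "nat \<Rightarrow> real"
      unfolding set by (rule sum.union_disjoint) auto
    define H where "H = (\<Sum>k\<in>{?m..<?m'}. \<bar>?b k\<bar>)"
    have head: "(\<Sum>k<?m. \<bar>?b k\<bar>) \<le> D ?m"
      unfolding D_def by (intro sum_mono C iS)
    have "(\<Sum>k. \<bar>?b k\<bar>) = (\<Sum>k. \<bar>?b (k + ?m')\<bar>) + ((\<Sum>k<?m. \<bar>?b k\<bar>) + H)"
      unfolding H_def split[symmetric] by (rule suminf_split_initial_segment[OF sa])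
    with head tail[of j] big[of j] have "real (Suc j) * (D ?m + 1 + real j) \<le> H" by linarith
    then have H: "D ?m + 1 + real j \<le> H / real (Suc j)"
      by (simp add: field_simps)
    have hump: "(\<Sum>k\<in>{?m..<?m'}. ?b k * x k) = H / real (Suc j)"
      unfolding H_def sum_divide_distrib
      by (intro sum.cong) (auto simp: x_def J_eq abs_sgn)
    have "\<bar>\<Sum>k<?m. ?b k * x k\<bar> \<le> (\<Sum>k<?m. \<bar>?b k * x k\<bar>)" by (rule sum_abs)
    also have "\<dots> \<le> (\<Sum>k<?m. \<bar>?b k\<bar>)" by (intro sum_mono le)
    finally have headx: "\<bar>\<Sum>k<?m. ?b k * x k\<bar> \<le> D ?m" using head by linarith
    have "\<bar>\<Sum>k. ?b (k + ?m') * x (k + ?m')\<bar> \<le> (\<Sum>k. \<bar>?b (k + ?m') * x (k + ?m')\<bar>)"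
      by (rule summable_rabs) (use sabs in \<open>simp only: summable_iff_shift[of "\<lambda>k. \<bar>?b k * x k\<bar>"]\<close>)
    also have "\<dots> \<le> (\<Sum>k. \<bar>?b (k + ?m')\<bar>)"
      by (intro suminf_le le)
        (use sa sabs in \<open>simp_all only: summable_iff_shift[of "\<lambda>k. \<bar>?b k * x k\<bar>"]
          summable_iff_shift[of "\<lambda>k. \<bar>?b k\<bar>"]\<close>)
    finally have tailx: "\<bar>\<Sum>k. ?b (k + ?m') * x (k + ?m')\<bar> \<le> 1" using tail[of j] by linarith
    have "(\<Sum>k. ?b k * x k) = (\<Sum>k. ?b (k + ?m') * x (k + ?m')) +
        ((\<Sum>k<?m. ?b k * x k) + (\<Sum>k\<in>{?m..<?m'}. ?b k * x k))"
      unfolding split[symmetric] by (rule suminf_split_initial_segment[OF sx])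
    with headx tailx hump H B[OF iS[of j]] show ?thesis by linarith
  qed
  then show False
    by (metis linorder_not_le reals_Archimedean2)
qed

text \<open>The truncations of \<open>c\<close> form a family of finitely supported rows. On a null
  sequence they give the partial sums of a convergent series, which are bounded, so the uniform
  bound on their masses bounds the partial sums of the absolute values.\<close>

lemma absolutely_summable_if_summable_null_multiples:
  fixes c :: "nat \<Rightarrow> real"
  assumes "\<And>x. x \<longlonglongrightarrow> 0 \<Longrightarrow> summable (\<lambda>k. c k * x k)"
  shows "summable (\<lambda>k. \<bar>c k\<bar>)"
proof -
  let ?b = "\<lambda>m k. if k < m then c k else 0"
  have sum_b: "(\<Sum>k. f k * (if k < m then g k else 0)) = (\<Sum>k<m. f k * g k)"
    for f g :: "nat \<Rightarrow> real" and m :: nat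
    by (subst suminf_finite[of "{..<m}"]) auto
  have "\<exists>C. \<forall>m\<in>UNIV. (\<Sum>k. \<bar>?b m k\<bar>) \<le> C"
  proof (rule uniform_boundedness_null_sequences)
    fix m show "summable (\<lambda>k. \<bar>?b m k\<bar>)"
      by (rule summable_finite[of "{..<m}"]) auto
  next
    fix x :: "nat \<Rightarrow> real" assume "x \<longlonglongrightarrow> 0"
    then have "convergent (\<lambda>m. \<Sum>k<m. c k * x k)"
      using assms summable_iff_convergent by blast
    then have "Bseq (\<lambda>m. \<Sum>k<m. c k * x k)" by (rule convergent_imp_Bseq)
    then obtain K where "\<And>m. \<bar>\<Sum>k<m. c k * x k\<bar> \<le> K"
      by (auto simp: Bseq_def)
    moreover have "(\<Sum>k. ?b m k * x k) = (\<Sum>k<m. c k * x k)" for m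
      using sum_b[of x m c] by (simp add: mult.commute)
    ultimately show "\<exists>B. \<forall>m\<in>UNIV. \<bar>\<Sum>k. ?b m k * x k\<bar> \<le> B" by auto
  qed
  then obtain C where C: "\<And>m. (\<Sum>k. \<bar>?b m k\<bar>) \<le> C" by auto
  have "(\<Sum>k<m. \<bar>c k\<bar>) \<le> C" for m
  proof -
    have "(\<Sum>k. \<bar>?b m k\<bar>) = (\<Sum>k<m. \<bar>c k\<bar>)"
      by (subst suminf_finite[of "{..<m}"]) auto
    with C[of m] show ?thesis by simp
  qed
  then show ?thesis
    by (intro bounded_imp_summable[of _ C])
      (simp_all only: lessThan_Suc_atMost[symmetric] abs_ge_zero)
qed

section \<open>Real form of (T1), and convergence along an ideal\<close>

text \<open>A finite supremum in \<open>ennreal\<close> forces every row to be absolutely summable,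
  after which the sums may be read in the reals.\<close>

lemma cond_T1_iff:
  "cond_T1 a \<longleftrightarrow>
    (\<exists>C. \<forall>n\<in>posnat. summable (\<lambda>k. \<bar>a n (Suc k)\<bar>) \<and> (\<Sum>k. \<bar>a n (Suc k)\<bar>) \<le> C)"
    (is "_ \<longleftrightarrow> ?R")
proof
  assume T1: "cond_T1 a"
  define C where "C = (SUP n\<in>posnat. \<Sum>k. ennreal \<bar>a n (Suc k)\<bar>)"
  have C: "C < \<infinity>" using T1 by (simp add: C_def cond_T1_def)
  have "summable (\<lambda>k. \<bar>a n (Suc k)\<bar>) \<and> (\<Sum>k. \<bar>a n (Suc k)\<bar>) \<le> enn2real C" if "n \<in> posnat" for n
  proof -
    have le: "(\<Sum>k. ennreal \<bar>a n (Suc k)\<bar>) \<le> C"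
      unfolding C_def by (rule SUP_upper) fact
    with C have "(\<Sum>k. ennreal \<bar>a n (Suc k)\<bar>) \<noteq> top"
      by (auto simp: top_unique)
    then have sm: "summable (\<lambda>k. \<bar>a n (Suc k)\<bar>)"
      by (intro summable_suminf_not_top) auto
    then have "ennreal (\<Sum>k. \<bar>a n (Suc k)\<bar>) \<le> C"
      using le by (simp add: suminf_ennreal2)
    then have "(\<Sum>k. \<bar>a n (Suc k)\<bar>) \<le> enn2real C"
      using C by (metis enn2real_ennreal enn2real_mono infinity_ennreal_def suminf_nonneg[OF sm] abs_ge_zero)
    with sm show ?thesis by simp
  qed
  then show ?R by blast
next
  assume ?R
  then obtain C where C: "\<And>n. n \<in> posnat \<Longrightarrow> summable (\<lambda>k. \<bar>a n (Suc k)\<bar>)"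
    "\<And>n. n \<in> posnat \<Longrightarrow> (\<Sum>k. \<bar>a n (Suc k)\<bar>) \<le> C"
    by metis
  have "(\<Sum>k. ennreal \<bar>a n (Suc k)\<bar>) \<le> ennreal C" if "n \<in> posnat" for n
    using C[OF that] by (simp only: suminf_ennreal2 abs_ge_zero ennreal_leI)
  then have "(SUP n\<in>posnat. \<Sum>k. ennreal \<bar>a n (Suc k)\<bar>) \<le> ennreal C"
    by (rule SUP_least)
  then show "cond_T1 a"
    unfolding cond_T1_def by (rule le_less_trans) (simp only: infinity_ennreal_def ennreal_less_top)
qed

lemma ideal_on_posnat_if_admissible: "admissible_ideal I \<Longrightarrow> ideal_on_posnat I"
  by (simp add: admissible_ideal_def)

lemma ideal_Un: "ideal_on_posnat I \<Longrightarrow> S \<in> I \<Longrightarrow> T \<in> I \<Longrightarrow> S \<union> T \<in> I"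
  by (simp add: ideal_on_posnat_def)

lemma ideal_subset: "ideal_on_posnat I \<Longrightarrow> S \<in> I \<Longrightarrow> T \<subseteq> S \<Longrightarrow> T \<in> I"
  by (auto simp: ideal_on_posnat_def)

lemma ideal_lim_if_tendsto:
  assumes "admissible_ideal I" "x \<longlonglongrightarrow> \<eta>"
  shows "ideal_lim I x \<eta>"
  unfolding ideal_lim_def
proof (intro allI impI)
  fix e :: real assume "e > 0"
  then obtain n0 where "\<forall>n\<ge>n0. \<bar>x n - \<eta>\<bar> < e"
    using LIMSEQ_D[OF assms(2)] by (auto simp: real_norm_def)
  then have "{n \<in> posnat. \<bar>x n - \<eta>\<bar> > e} \<subseteq> {..<n0}"
    by (metis (mono_tags, lifting) lessThan_iff linorder_not_le mem_Collect_eq order_less_asym subsetI)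
  then have "finite {n \<in> posnat. \<bar>x n - \<eta>\<bar> > e}"
    by (rule finite_subset) simp
  with assms(1) show "{n \<in> posnat. \<bar>x n - \<eta>\<bar> > e} \<in> I"
    unfolding admissible_ideal_def by (metis (no_types, lifting) mem_Collect_eq subsetI)
qed

lemma bounded_seqs_iff: "x \<in> bounded_seqs \<longleftrightarrow> (\<exists>K. \<forall>n\<in>posnat. \<bar>x n\<bar> \<le> K)"
  by (simp add: bounded_seqs_def bounded_iff)

text \<open>Supplies the test sequences for necessity: null sequences for \<open>cond_T1\<close> and
  the constant 1 for \<open>cond_T2\<close>.\<close>

lemma tendsto_in_domain:
  assumes "admissible_ideal I" "x \<longlonglongrightarrow> \<eta>"
  shows "x \<in> ideal_conv_seqs I \<inter> bounded_seqs"
proof -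
  have "Bseq x" using assms(2) convergentI convergent_imp_Bseq by blast
  then have "x \<in> bounded_seqs" by (auto simp: bounded_seqs_iff Bseq_def)
  with ideal_lim_if_tendsto[OF assms] show ?thesis
    by (auto simp: ideal_conv_seqs_def)
qed

section \<open>Necessity of (T1) and (T2)\<close>

lemma cond_T1_if_regular:
  assumes "admissible_ideal I" "ideal_regular I J a"
  shows "cond_T1 a"
proof -
  have *: "(\<forall>n\<in>posnat. summable (\<lambda>k. a n (Suc k) * x k)) \<and>
      (\<exists>B. \<forall>n\<in>posnat. \<bar>\<Sum>k. a n (Suc k) * x k\<bar> \<le> B)" if "x \<longlonglongrightarrow> 0" for x
  proof -
    \<comment> \<open>Matrix columns start at 1 while the test sequence \<open>x\<close> starts at
      0, so \<open>y\<close> is arranged to satisfy \<open>y (Suc k) = x k\<close>.\<close>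
    define y where "y k = x (k - 1)" for k
    have "(\<lambda>k. y (Suc k)) \<longlonglongrightarrow> 0" using that by (simp add: y_def)
    then have "y \<longlonglongrightarrow> 0" by (rule LIMSEQ_imp_Suc)
    \<comment> \<open>Well-definedness feeds the argument for a single row; boundedness of the image
      is the pointwise bound over all rows.\<close>
    from tendsto_in_domain[OF assms(1) this] assms(2)
    have "mat_app_defined a y" "mat_app a y \<in> bounded_seqs"
      by (auto simp: ideal_regular_def mat_class_def)
    then show ?thesis
      by (simp add: mat_app_defined_def mat_app_def[abs_def] bounded_seqs_iff y_def)
  qed
  have sm: "summable (\<lambda>k. \<bar>a n (Suc k)\<bar>)" if "n \<in> posnat" for n
    by (rule absolutely_summable_if_summable_null_multiples) (use * that in blast)
  have "\<exists>C. \<forall>n\<in>posnat. (\<Sum>k. \<bar>a n (Suc k)\<bar>) \<le> C"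
    by (rule uniform_boundedness_null_sequences) (use sm * in blast)+
  with sm show ?thesis unfolding cond_T1_iff by metis
qed

lemma cond_T2_if_regular:
  assumes "admissible_ideal I" "ideal_regular I J a"
  shows "cond_T2 J a"
proof -
  have lim: "(\<lambda>_::nat. 1::real) \<longlonglongrightarrow> 1" by simp
  have "mat_app_defined a (\<lambda>_. 1) \<and> ideal_lim J (mat_app a (\<lambda>_. 1)) 1"
    using assms(2) tendsto_in_domain[OF assms(1) lim] ideal_lim_if_tendsto[OF assms(1) lim]
    by (auto simp: ideal_regular_def mat_class_def)
  then show ?thesis
    by (simp add: cond_T2_def mat_app_defined_def mat_app_def[abs_def])
qed

section \<open>Sufficiency of (T1), (T2) and (T3)\<close>

text \<open>Links the unordered sums over \<open>E\<close> in \<open>cond_T3\<close> with the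
  shifted series used in the estimates; absolute summability makes the two notions agree.\<close>

lemma suminf_indicator_Suc_eq_infsum:
  fixes c :: "nat \<Rightarrow> real"
  assumes "E \<subseteq> posnat" "summable (\<lambda>k. \<bar>c (Suc k)\<bar>)"
  shows "(\<Sum>k. \<bar>c (Suc k)\<bar> * indicator E (Suc k)) = (\<Sum>\<^sub>\<infinity>k\<in>E. \<bar>c k\<bar>)"
proof -
  let ?f = "\<lambda>k. \<bar>c k\<bar> * indicator E k"
  have "summable (\<lambda>k. ?f (Suc k))"
    by (rule summable_comparison_test'[OF assms(2)]) (auto simp: indicator_def)
  then have "(\<lambda>k. ?f (Suc k)) summable_on UNIV"
    by (intro norm_summable_imp_summable_on) simp
  then have "(\<Sum>k. ?f (Suc k)) = (\<Sum>\<^sub>\<infinity>k. ?f (Suc k))"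
    using has_sum_imp_sums has_sum_infsum sums_unique by metis
  also have "\<dots> = (\<Sum>\<^sub>\<infinity>k\<in>range Suc. ?f k)"
    by (subst infsum_reindex) (auto simp: o_def)
  also have "\<dots> = (\<Sum>\<^sub>\<infinity>k\<in>E. \<bar>c k\<bar>)"
  proof (rule infsum_cong_neutral)
    \<comment> \<open>This case is vacuous: only 0 is not a successor, and \<open>E\<close> omits
      0.\<close>
    fix k assume "k \<in> E - range Suc"
    with assms(1) have "k \<ge> 1" "k \<notin> range Suc" by auto
    then show "\<bar>c k\<bar> = 0" by (cases k) auto
  qed auto
  finally show ?thesis .
qed

text \<open>\<open>F\<close> is an exceptional set: \<open>y\<close> is of size at most
  \<open>e\<close> off \<open>F\<close> and at most \<open>B + e\<close> on it. With
  \<open>F\<close> empty this gives boundedness of the image, with the set of bad indices it gives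
  the limit.\<close>

lemma abs_suminf_mult_le:
  fixes c y :: "nat \<Rightarrow> real"
  assumes sm: "summable (\<lambda>k. \<bar>c k\<bar>)"
    and y: "\<And>k. \<bar>y k\<bar> \<le> B * indicator F k + e"
    and "B \<ge> 0"
  shows "summable (\<lambda>k. c k * y k)"
    and "\<bar>\<Sum>k. c k * y k\<bar> \<le> B * (\<Sum>k. \<bar>c k\<bar> * indicator F k) + e * (\<Sum>k. \<bar>c k\<bar>)"
proof -
  let ?g = "\<lambda>k. B * (\<bar>c k\<bar> * indicator F k) + e * \<bar>c k\<bar>"
  have sF: "summable (\<lambda>k. \<bar>c k\<bar> * indicator F k)"
    by (rule summable_comparison_test'[OF sm]) (auto simp: indicator_def)
  have sg: "summable ?g"
    by (intro summable_add summable_mult sF sm)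
  have le: "\<bar>c k * y k\<bar> \<le> ?g k" for k
    using mult_left_mono[OF y[of k], of "\<bar>c k\<bar>"] by (simp add: abs_mult algebra_simps)
  have sabs: "summable (\<lambda>k. \<bar>c k * y k\<bar>)"
    by (rule summable_comparison_test'[OF sg]) (use le in auto)
  then show "summable (\<lambda>k. c k * y k)" by (rule summable_rabs_cancel)
  have "\<bar>\<Sum>k. c k * y k\<bar> \<le> (\<Sum>k. \<bar>c k * y k\<bar>)" by (rule summable_rabs[OF sabs])
  also have "\<dots> \<le> (\<Sum>k. ?g k)" by (intro suminf_le le sabs sg)
  also have "\<dots> = B * (\<Sum>k. \<bar>c k\<bar> * indicator F k) + e * (\<Sum>k. \<bar>c k\<bar>)"
    using suminf_add[OF summable_mult[OF sF, of B] summable_mult[OF sm, of e]]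
      suminf_mult[OF sF, of B] suminf_mult[OF sm, of e] by simp
  finally show "\<bar>\<Sum>k. c k * y k\<bar> \<le> B * (\<Sum>k. \<bar>c k\<bar> * indicator F k) + e * (\<Sum>k. \<bar>c k\<bar>)" .
qed

lemma mat_app_bounded_if_T1:
  assumes "cond_T1 a" "x \<in> bounded_seqs"
  shows "mat_app_defined a x" "mat_app a x \<in> bounded_seqs"
proof -
  obtain M where M: "\<And>n. n \<in> posnat \<Longrightarrow> summable (\<lambda>k. \<bar>a n (Suc k)\<bar>)"
    "\<And>n. n \<in> posnat \<Longrightarrow> (\<Sum>k. \<bar>a n (Suc k)\<bar>) \<le> M"
    using assms(1) unfolding cond_T1_iff by metis
  obtain K where K: "\<And>k. k \<in> posnat \<Longrightarrow> \<bar>x k\<bar> \<le> K"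
    using assms(2) unfolding bounded_seqs_iff by metis
  \<comment> \<open>No exceptional set here: the bound \<open>K\<close> plays the part of
    \<open>e\<close>.\<close>
  then have K': "\<bar>x (Suc k)\<bar> \<le> 0 * indicator {} k + K" for k by simp
  have "K \<ge> 0" using K[of 1] by simp
  note est = abs_suminf_mult_le[OF M(1) K']
  show "mat_app_defined a x"
    unfolding mat_app_defined_def using est(1) by simp
  have "\<bar>mat_app a x n\<bar> \<le> K * M" if "n \<in> posnat" for n
    using est(2)[OF that] mult_left_mono[OF M(2)[OF that] \<open>K \<ge> 0\<close>] by (simp add: mat_app_def)
  then show "mat_app a x \<in> bounded_seqs" unfolding bounded_seqs_iff by metis
qed

text \<open>The error at \<open>n\<close> is the sum of \<open>a n k * (x k - \<eta>)\<close> plus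
  \<open>\<eta>\<close> times the defect of the row sum from 1. It is split into three parts of at
  most \<open>d / 3\<close>: columns in \<open>E\<close> by (T3), columns outside \<open>E\<close>
  by (T1), and the defect by (T2).\<close>

lemma ideal_lim_mat_app:
  assumes J: "admissible_ideal J"
    and T1: "cond_T1 a" and T2: "cond_T2 J a" and T3: "cond_T3 I J a"
    and x: "x \<in> bounded_seqs" and lim: "ideal_lim I x \<eta>"
  shows "ideal_lim J (mat_app a x) \<eta>"
  unfolding ideal_lim_def
proof (intro allI impI)
  fix d :: real assume "d > 0"
  obtain M0 where M0: "\<And>n. n \<in> posnat \<Longrightarrow> summable (\<lambda>k. \<bar>a n (Suc k)\<bar>)"
    "\<And>n. n \<in> posnat \<Longrightarrow> (\<Sum>k. \<bar>a n (Suc k)\<bar>) \<le> M0"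
    using T1 unfolding cond_T1_iff by metis
  obtain K where K: "\<And>k. k \<in> posnat \<Longrightarrow> \<bar>x k\<bar> \<le> K"
    using x unfolding bounded_seqs_iff by metis
  \<comment> \<open>The added 1 keeps the denominators positive. \<open>B\<close> dominates
    \<open>\<bar>x k - \<eta>\<bar>\<close>, and \<open>e\<close> is chosen so that
    \<open>e * M = d / 3\<close>.\<close>
  define M where "M = \<bar>M0\<bar> + 1"
  define B where "B = \<bar>K\<bar> + \<bar>\<eta>\<bar> + 1"
  define e where "e = d / (3 * M)"
  have pos: "M > 0" "B > 0" by (auto simp: M_def B_def)
  then have "e > 0" using \<open>d > 0\<close> by (simp add: e_def)
  define E where "E = {k \<in> posnat. \<bar>x k - \<eta>\<bar> > e}"
  have E: "E \<in> I" using lim \<open>e > 0\<close> by (simp add: E_def ideal_lim_def)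
  define S where "S n = (\<Sum>\<^sub>\<infinity>k\<in>E. \<bar>a n k\<bar>)" for n
  define R where "R n = (\<Sum>k. a n (Suc k))" for n
  \<comment> \<open>\<open>U\<close> and \<open>V\<close> are the rows where (T3) and (T2) fail to
    give their \<open>d / 3\<close>; \<open>\<bar>\<eta>\<bar> + 1\<close> in \<open>V\<close>
    covers the case \<open>\<eta> = 0\<close>.\<close>
  define U where "U = {n \<in> posnat. \<bar>S n - 0\<bar> > d / (3 * B)}"
  define V where "V = {n \<in> posnat. \<bar>R n - 1\<bar> > d / (3 * (\<bar>\<eta>\<bar> + 1))}"
  have "U \<in> J"
    using T3 E pos \<open>d > 0\<close> by (auto simp: U_def S_def cond_T3_def ideal_lim_def)
  moreover have "V \<in> J"
    using T2 \<open>d > 0\<close> by (auto simp: V_def R_def cond_T2_def ideal_lim_def)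
  ultimately have "U \<union> V \<in> J"
    using ideal_Un[OF ideal_on_posnat_if_admissible[OF J]] by blast
  moreover have "{n \<in> posnat. \<bar>mat_app a x n - \<eta>\<bar> > d} \<subseteq> U \<union> V"
  proof (rule subsetI, rule ccontr)
    fix n assume n_in: "n \<in> {n \<in> posnat. \<bar>mat_app a x n - \<eta>\<bar> > d}" and "n \<notin> U \<union> V"
    from n_in have n: "n \<in> posnat" and gt: "\<bar>mat_app a x n - \<eta>\<bar> > d" by blast+
    with \<open>n \<notin> U \<union> V\<close> have nU: "\<bar>S n\<bar> \<le> d / (3 * B)"
      and nV: "\<bar>R n - 1\<bar> \<le> d / (3 * (\<bar>\<eta>\<bar> + 1))"
      by (simp_all add: U_def V_def not_less)
    \<comment> \<open>The preimage under \<open>Suc\<close> moves \<open>E\<close> to the numbering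
      from 0 used by the series.\<close>
    have y: "\<bar>x (Suc k) - \<eta>\<bar> \<le> B * indicator (Suc -` E) k + e" for k
      using K[of "Suc k"] \<open>e > 0\<close> by (auto simp: indicator_def E_def B_def)
    note est = abs_suminf_mult_le[OF M0(1)[OF n] y less_imp_le[OF pos(2)]]
    have "summable (\<lambda>k. a n (Suc k))" using T2 n by (simp add: cond_T2_def)
    then have "(\<Sum>k. a n (Suc k) * (x (Suc k) - \<eta>) + \<eta> * a n (Suc k)) =
        (\<Sum>k. a n (Suc k) * (x (Suc k) - \<eta>)) + \<eta> * R n"
      using est(1) by (simp add: suminf_add[symmetric] suminf_mult summable_mult R_def)
    then have split: "mat_app a x n - \<eta> =
        (\<Sum>k. a n (Suc k) * (x (Suc k) - \<eta>)) + \<eta> * (R n - 1)"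
      by (simp add: mat_app_def algebra_simps)
    have "E \<subseteq> posnat" by (auto simp: E_def)
    from suminf_indicator_Suc_eq_infsum[OF this M0(1)[OF n]]
    have mass: "(\<Sum>k. \<bar>a n (Suc k)\<bar> * indicator (Suc -` E) k) = S n"
      by (simp add: S_def indicator_def)
    have "B * S n \<le> B * (d / (3 * B))"
      using pos nU by (intro mult_left_mono) auto
    then have "B * S n \<le> d / 3" using pos by simp
    moreover have "e * (\<Sum>k. \<bar>a n (Suc k)\<bar>) \<le> e * M"
      using \<open>e > 0\<close> M0(2)[OF n] by (intro mult_left_mono) (auto simp: M_def)
    then have "e * (\<Sum>k. \<bar>a n (Suc k)\<bar>) \<le> d / 3" using pos by (simp add: e_def)
    ultimately have 1: "\<bar>\<Sum>k. a n (Suc k) * (x (Suc k) - \<eta>)\<bar> \<le> 2 * d / 3"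
      using est(2) unfolding mass by linarith
    have "\<bar>\<eta> * (R n - 1)\<bar> \<le> (\<bar>\<eta>\<bar> + 1) * (d / (3 * (\<bar>\<eta>\<bar> + 1)))"
      unfolding abs_mult using nV by (intro mult_mono) auto
    also have "\<dots> = d / 3" by (simp add: field_simps)
    finally show False using 1 gt split by linarith
  qed
  ultimately show "{n \<in> posnat. \<bar>mat_app a x n - \<eta>\<bar> > d} \<in> J"
    using ideal_subset[OF ideal_on_posnat_if_admissible[OF J]] by blast
qed

lemma regular_if_T1_T2_T3:
  assumes "admissible_ideal J" "cond_T1 a" "cond_T2 J a" "cond_T3 I J a"
  shows "ideal_regular I J a"
proof -
  have "mat_app a x \<in> ideal_conv_seqs J" if "x \<in> ideal_conv_seqs I" "x \<in> bounded_seqs" for x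
    using that ideal_lim_mat_app[OF assms] by (auto simp: ideal_conv_seqs_def)
  then show ?thesis
    using mat_app_bounded_if_T1[OF assms(2)] ideal_lim_mat_app[OF assms]
    by (simp add: ideal_regular_def mat_class_def)
qed

theorem theorem1p2:
  fixes I J :: "nat set set" and a :: "nat \<Rightarrow> nat \<Rightarrow> real"
  assumes "admissible_ideal I" and "admissible_ideal J"
  shows "(cond_T1 a \<and> cond_T2 J a \<and> cond_T3 I J a \<longrightarrow> ideal_regular I J a) \<and>
         (ideal_regular I J a \<longrightarrow> cond_T1 a \<and> cond_T2 J a)"
  using regular_if_T1_T2_T3[OF assms(2)] cond_T1_if_regular[OF assms(1)]
    cond_T2_if_regular[OF assms(1)] by blast

end
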